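(* Let $\omega_h\ge 0$ and $k_h>0$, and let $\mathcal H$ be the discrete-time hybrid integrator-gain system (HIGS) with input $e_k\in\mathbb R$, state $\widetilde x_k\in\mathbb R$ and output $\widetilde y_k\in\mathbb R$ given by $$\mathcal H:\quad \begin{cases}\widetilde x_{k+1}=\widetilde x_k+\omega_h e_k, & \text{if } (\widetilde x_k,e_k)\in\mathcal F,\\ \widetilde x_{k+1}=k_h e_k, & \text{if } (\widetilde x_k,e_k)\notin\mathcal F,\\ \widetilde y_k=\widetilde x_{k+1},\end{cases}$$ where $\mathcal F=\{(x,e)\in\mathbb R^2 : (x+\omega_h e)\,e\ge \tfrac{1}{k_h}(x+\omega_h e)^2\}$. Then $\mathcal H$ is a step-advanced negative imaginary (SANI) system with the storage function $$\widetilde V(\widetilde x_k)=\frac{1}{2k_h}\widetilde x_k^2$$ satisfying $$\widetilde V(\widetilde x_{k+1})-\widetilde V(\widetilde x_k)\le e_k(\widetilde x_{k+1}-\widetilde x_k)$$ for any input $e_k\in\mathbb R$ and any state $\widetilde x_k\in\mathbb R$.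
   Context: A function $V:\mathbb R^n\to\mathbb R$ is positive definite if $V(0)=0$ and $V(x)>0$ for all $x\ne 0$. Step-advanced negative imaginary (SANI) system: consider a discrete-time system $\widetilde x_{k+1}=\widetilde f(\widetilde x_k,\widetilde u_k)$, $\widetilde y_k=\widetilde h(\widetilde x_k,\widetilde u_k)$, $k\in\mathbb N$, with $\widetilde f:\mathbb R^n\times\mathbb R^p\to\mathbb R^n$ and $\widetilde h:\mathbb R^n\times\mathbb R^p\to\mathbb R^p$, where $\widetilde u_k,\widetilde y_k\in\mathbb R^p$ and $\widetilde x_k\in\mathbb R^n$ are the input, output and state. It is called SANI if there exists a function $\widehat h:\mathbb R^n\to\mathbb R^p$ such that: (1) $\widetilde h(\widetilde x_k,\widetilde u_k)=\widehat h(\widetilde f(\widetilde x_k,\widetilde u_k))$; (2) there exists a positive definite function $\widetilde V:\mathbb R^n\to\mathbb R$ (a storage function) such that for arbitrary state $\widetilde x_k$ and input $\widetilde u_k$, $$\widetilde V(\widetilde x_{k+1})-\widetilde V(\widetilde x_k)\le \widetilde u_k^T\left(\widehat h(\widetilde x_{k+1})-\widehat h(\widetilde x_k)\right)\quad\text{for all } k.$$ For the HIGS, $n=p=1$ and the input $\widetilde u_k$ is $e_k$. The constants $\omega_h$ and $k_h$ are called the integrator frequency and the gain value. *)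

theory Defs
  imports "HOL-Analysis.Analysis"
begin

definition positive_definite :: "('a::real_vector \<Rightarrow> real) \<Rightarrow> bool" where
  "positive_definite V \<longleftrightarrow> V 0 = 0 \<and> (\<forall>x. x \<noteq> 0 \<longrightarrow> V x > 0)"

(* A system x(k+1) = f(x(k), u(k)), y(k) = h(x(k), u(k)) is represented by the pair of curried
   maps f and h.  The state space R^n and the common input and output space R^p are arbitrary
   Euclidean spaces; in particular n = 1 or p = 1 is the instance real, whose inner product is
   multiplication. *)

definition trajectory :: "('x \<Rightarrow> 'u \<Rightarrow> 'x) \<Rightarrow> (nat \<Rightarrow> 'u) \<Rightarrow> (nat \<Rightarrow> 'x) \<Rightarrow> bool" where
  "trajectory f u x \<longleftrightarrow> (\<forall>k. x (Suc k) = f (x k) (u k))"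

definition SANI_with_storage ::
  "('x::euclidean_space \<Rightarrow> 'u::euclidean_space \<Rightarrow> 'x) \<Rightarrow> ('x \<Rightarrow> 'u \<Rightarrow> 'u) \<Rightarrow>
   ('x \<Rightarrow> 'u) \<Rightarrow> ('x \<Rightarrow> real) \<Rightarrow> bool" where
  "SANI_with_storage f h hhat V \<longleftrightarrow>
     (\<forall>x u. h x u = hhat (f x u)) \<and>
     positive_definite V \<and>
     (\<forall>u x. trajectory f u x \<longrightarrow>
        (\<forall>k. V (x (Suc k)) - V (x k) \<le> u k \<bullet> (hhat (x (Suc k)) - hhat (x k))))"

definition SANI ::
  "('x::euclidean_space \<Rightarrow> 'u::euclidean_space \<Rightarrow> 'x) \<Rightarrow> ('x \<Rightarrow> 'u \<Rightarrow> 'u) \<Rightarrow> bool" where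
  "SANI f h \<longleftrightarrow> (\<exists>hhat V. SANI_with_storage f h hhat V)"

definition higs_region :: "real \<Rightarrow> real \<Rightarrow> (real \<times> real) set" where
  "higs_region \<omega>h kh = {(x, e). (x + \<omega>h * e) * e \<ge> (1 / kh) * (x + \<omega>h * e)\<^sup>2}"

definition higs_next :: "real \<Rightarrow> real \<Rightarrow> real \<Rightarrow> real \<Rightarrow> real" where
  "higs_next \<omega>h kh x e = (if (x, e) \<in> higs_region \<omega>h kh then x + \<omega>h * e else kh * e)"

(* The output is the updated state: y(k) = x(k+1). *)
definition higs_output :: "real \<Rightarrow> real \<Rightarrow> real \<Rightarrow> real \<Rightarrow> real" where
  "higs_output \<omega>h kh x e = higs_next \<omega>h kh x e"

definition higs_storage :: "real \<Rightarrow> real \<Rightarrow> real" where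
  "higs_storage kh x = 1 / (2 * kh) * x\<^sup>2"

end

theory Submission
  imports Defs
begin

text \<open>The output is the next state, so \<open>hhat\<close> can be the identity and only the
  dissipation inequality needs work. Cleared of denominators, it asks that 2 kh e (z - x) - (z^2 -
  x^2) be nonnegative, z being the next state. In gain mode, z = kh e makes this the square (kh e -
  x)^2. In integrator mode it is a multiple of \<omega>h whose cofactor is nonnegative by
  \<open>higs_sector_bound\<close>.\<close>

lemma higs_storage_diff_le_iff:
  assumes "kh > 0"
  shows "higs_storage kh z - higs_storage kh x \<le> e * (z - x) \<longleftrightarrow>
    z\<^sup>2 - x\<^sup>2 \<le> 2 * kh * (e * (z - x))"
  using assms by (simp add: higs_storage_def field_simps)

lemma positive_definite_higs_storage:
  assumes "kh > 0"
  shows "positive_definite (higs_storage kh)"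
  using assms by (simp add: positive_definite_def higs_storage_def)

text \<open>The hypothesis says that z lies between 0 and kh e. Expanding (kh e - z)^2 and bounding
  its z^2 term by the hypothesis leaves a multiple of kh, which can be cancelled.\<close>

lemma higs_sector_bound:
  fixes kh z e :: real
  assumes "kh > 0" and "z\<^sup>2 \<le> kh * (z * e)"
  shows "z * e \<le> kh * e\<^sup>2"
proof -
  have "0 \<le> (kh * e - z)\<^sup>2" by simp
  also have "\<dots> \<le> kh * (kh * e\<^sup>2 - z * e)"
    using assms(2) by (simp add: power2_eq_square algebra_simps)
  finally show ?thesis
    using assms(1) by (simp add: zero_le_mult_iff)
qed

lemma higs_dissipation:
  assumes "\<omega>h \<ge> 0" and "kh > 0"
  shows "higs_storage kh (higs_next \<omega>h kh x e) - higs_storage kh x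
    \<le> e * (higs_next \<omega>h kh x e - x)"
proof (cases "(x, e) \<in> higs_region \<omega>h kh")
  case True
  define z where "z = x + \<omega>h * e"
  have "z\<^sup>2 \<le> kh * (z * e)"
    using True assms(2) by (simp add: higs_region_def z_def field_simps)
  \<comment> \<open>The slack factored: z - x = \<omega>h e and z + x = 2z - \<omega>h e, so z^2 -
    x^2 = \<omega>h e (2z - \<omega>h e).\<close>
  then have "0 \<le> \<omega>h * (2 * (kh * e\<^sup>2 - z * e) + \<omega>h * e\<^sup>2)"
    using assms higs_sector_bound by simp
  also have "\<dots> = 2 * kh * (e * (z - x)) - (z\<^sup>2 - x\<^sup>2)"
    by (simp add: z_def power2_eq_square algebra_simps)
  finally have "higs_storage kh z - higs_storage kh x \<le> e * (z - x)"
    by (simp only: higs_storage_diff_le_iff[OF assms(2)] diff_ge_0_iff_ge)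
  then show ?thesis
    using True by (simp add: higs_next_def z_def)
next
  case False
  have "0 \<le> (kh * e - x)\<^sup>2" by simp
  also have "\<dots> = 2 * kh * (e * (kh * e - x)) - ((kh * e)\<^sup>2 - x\<^sup>2)"
    by (simp add: power2_eq_square algebra_simps)
  finally show ?thesis
    using False assms(2) by (simp add: higs_storage_diff_le_iff higs_next_def)
qed

theorem theorem1:
  fixes \<omega>h kh :: real
  assumes "\<omega>h \<ge> 0" and "kh > 0"
  shows "SANI (higs_next \<omega>h kh) (higs_output \<omega>h kh) \<and>
    (\<exists>hhat. SANI_with_storage (higs_next \<omega>h kh) (higs_output \<omega>h kh) hhat (higs_storage kh)) \<and>
    (\<forall>x e. higs_storage kh (higs_next \<omega>h kh x e) - higs_storage kh x
             \<le> e * (higs_next \<omega>h kh x e - x))"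
proof -
  \<comment> \<open>With the identity as \<open>hhat\<close>, the trajectory inequality is the
    one-step bound at each k.\<close>
  have "SANI_with_storage (higs_next \<omega>h kh) (higs_output \<omega>h kh) (\<lambda>x. x) (higs_storage kh)"
    using assms positive_definite_higs_storage higs_dissipation
    by (simp add: SANI_with_storage_def higs_output_def trajectory_def)
  then show ?thesis
    using assms higs_dissipation unfolding SANI_def by blast
qed

end
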